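(* Let $f\in\mathcal{R}$ have the power series expansion $f(z)=z+a_2z^2+a_3z^3+\cdots$ in $\mathbb{D}$. Then \[ |H_3(1)| \le \frac{207}{540}, \] where $H_3(1)=a_3(a_2a_4-a_3^2)-a_4(a_4-a_2a_3)+a_5(a_3-a_2^2)$.
   Context: Let $\mathbb{D}=\{z\in\mathbb{C}: |z|<1\}$ be the open unit disk. Let $\mathcal{A}$ be the class of functions $f$ analytic in $\mathbb{D}$ of the form $f(z)=z+a_2z^2+a_3z^3+\cdots$. The class $\mathcal{R}\subset\mathcal{A}$ (functions of bounded turning) consists of the univalent functions $f\in\mathcal{A}$ satisfying $\operatorname{Re} f'(z)>0$ for all $z\in\mathbb{D}$. The third Hankel determinant of $f\in\mathcal{A}$ is \[ H_3(1)=\begin{vmatrix} 1 & a_2 & a_3\\ a_2 & a_3 & a_4\\ a_3 & a_4 & a_5\end{vmatrix} = a_3(a_2a_4-a_3^2)-a_4(a_4-a_2a_3)+a_5(a_3-a_2^2). \] *)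

theory Defs
  imports "HOL-Complex_Analysis.Complex_Analysis"
begin

abbreviation unit_disk :: "complex set" where
  "unit_disk \<equiv> ball 0 1"

definition normalized_expansion :: "(complex \<Rightarrow> complex) \<Rightarrow> (nat \<Rightarrow> complex) \<Rightarrow> bool" where
  "normalized_expansion f a \<longleftrightarrow>
     a 0 = 0 \<and> a 1 = 1 \<and> (\<forall>z\<in>unit_disk. (\<lambda>n. a n * z ^ n) sums f z)"

definition class_A :: "(complex \<Rightarrow> complex) set" where
  "class_A = {f. f analytic_on unit_disk \<and> (\<exists>a. normalized_expansion f a)}"

definition class_R :: "(complex \<Rightarrow> complex) set" where
  "class_R = {f \<in> class_A. inj_on f unit_disk \<and> (\<forall>z\<in>unit_disk. Re (deriv f z) > 0)}"

definition third_hankel :: "(nat \<Rightarrow> complex) \<Rightarrow> complex" where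
  "third_hankel a =
     det (vector [vector [1,   a 2, a 3],
                  vector [a 2, a 3, a 4],
                  vector [a 3, a 4, a 5]] :: complex ^ 3 ^ 3)"

lemma third_hankel_expand:
  "third_hankel a =
     a 3 * (a 2 * a 4 - (a 3)\<^sup>2) - a 4 * (a 4 - a 2 * a 3) + a 5 * (a 3 - (a 2)\<^sup>2)"
  by (simp add: third_hankel_def det_3 vector_3 algebra_simps power2_eq_square)

end

theory Submission
  imports Defs
begin

text \<open>
  The bound comes from passing from the function \<open>p = f'\<close> with positive real part to the Schwarz
  function \<open>\<omega> = (p - 1) / (p + 1) = w\<^sub>1 z + w\<^sub>2 z\<^sup>2 + \<dots>\<close>, which maps the disk into itself. The relation
  \<open>\<omega> (p + 1) = p - 1\<close> expresses \<open>a\<^sub>2, \<dots>, a\<^sub>5\<close> by \<open>w\<^sub>1, \<dots>, w\<^sub>4\<close>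
  (\<open>coefficients_of_schwarz_relation\<close>), and in these variables the Hankel determinant becomes
  \<open>2/15 (2 w\<^sub>2 - w\<^sub>1\<^sup>2) w\<^sub>4 - w\<^sub>3\<^sup>2/4 + w\<^sub>1 w\<^sub>3 (2 w\<^sub>2 - w\<^sub>1\<^sup>2)/10 - 4/135 w\<^sub>2\<^sup>3
    + w\<^sub>1\<^sup>2 w\<^sub>2\<^sup>2/9 - w\<^sub>1\<^sup>4 w\<^sub>2/45 - 7/540 w\<^sub>1\<^sup>6\<close>.

  The cancellation behind this form makes all coefficients small, so crude estimates suffice: the
  triangle inequality, and the one constraint \<open>\<bar>w\<^sub>1\<bar>\<^sup>2 + \<bar>w\<^sub>2\<bar>\<^sup>2 + \<bar>w\<^sub>3\<bar>\<^sup>2 + \<bar>w\<^sub>4\<bar>\<^sup>2 \<le> 1\<close>, which is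
  Bessel's inequality for the bounded function \<open>\<omega>\<close> on circles of radius \<open>r \<rightarrow> 1\<close>
  (\<open>bessel_inequality_disk\<close>). Replacing mixed products of the moduli by squares with the inequality
  of the arithmetic and geometric means leaves a weighted sum of these four squares with all
  weights below \<open>207/540\<close> (\<open>hankel_majorant_bound\<close>).
\<close>

section \<open>Bessel's inequality for bounded holomorphic functions\<close>

text \<open>
  This is Cauchy's formula for the \<open>k\<close>-th derivative at the centre, with the circle parametrised
  by the angle: a Taylor coefficient is a Fourier coefficient of the boundary values.
\<close>

lemma has_integral_fourier_coefficient:
  assumes hol: "g holomorphic_on ball 0 1" and r: "0 < r" "r < 1"
  shows "((\<lambda>t. g (of_real r * cis t) * cis (- (real k * t))) has_integral
           of_real (2 * pi * r ^ k) * fps_nth (fps_expansion g 0) k) {0..2 * pi}"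
proof -
  have cont: "continuous_on (cball 0 r) g" and holr: "g holomorphic_on ball 0 r"
    using r by (auto intro!: holomorphic_on_imp_continuous_on holomorphic_on_subset[OF hol])
  let ?I = "(2 * pi * \<i>) / fact k * (deriv ^^ k) g 0"
  have "((\<lambda>u. g u / (u - 0) ^ Suc k) has_contour_integral ?I) (part_circlepath 0 r 0 (2 * pi))"
    using Cauchy_has_contour_integral_higher_derivative_circlepath[OF cont holr, of 0 k] r
    by (simp add: circlepath_def)
  then have "((\<lambda>t. g (0 + r * cis t) / (0 + r * cis t - 0) ^ Suc k * r * \<i> * cis t)
               has_integral ?I) {0..2 * pi}"
    by (subst (asm) has_contour_integral_part_circlepath_iff) simp_all
  from has_integral_mult_left[OF this, of "of_real r ^ k / \<i>"]
  have "((\<lambda>t. g (r * cis t) / (r * cis t) ^ Suc k * r * \<i> * cis t * (of_real r ^ k / \<i>))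
               has_integral ?I * (of_real r ^ k / \<i>)) {0..2 * pi}"
    by simp
  moreover have "g (r * cis t) / (r * cis t) ^ Suc k * r * \<i> * cis t * (of_real r ^ k / \<i>)
      = g (of_real r * cis t) * cis (- (real k * t))" for t
  proof -
    have "cis t ^ k * cis (- (real k * t)) = 1"
      unfolding Complex.DeMoivre cis_mult by simp
    then have "cis (- (real k * t)) = 1 / cis t ^ k"
      by (simp add: field_simps)
    then show ?thesis
      using r by (simp add: power_mult_distrib field_simps)
  qed
  moreover have "?I * (of_real r ^ k / \<i>) = of_real (2 * pi * r ^ k) * fps_nth (fps_expansion g 0) k"
    by (simp add: fps_expansion_def algebra_simps)
  ultimately show ?thesis
    by simp
qed

text \<open>
  On the circle of radius \<open>r\<close>, the Taylor polynomial \<open>Q\<close> is the orthogonal projection of \<open>g\<close> onto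
  the first \<open>n\<close> characters. So \<open>g\<close> and \<open>Q\<close> have the same inner product with \<open>Q\<close>, and integrating
  \<open>0 \<le> \<bar>g - Q\<bar>\<^sup>2 \<le> 1 - 2 Re (g cnj Q) + \<bar>Q\<bar>\<^sup>2\<close> bounds the squared norm of \<open>Q\<close> by that of the
  constant 1.
\<close>

lemma bessel_inequality_disk:
  assumes hol: "g holomorphic_on ball 0 1"
    and bound: "\<And>z. z \<in> ball 0 1 \<Longrightarrow> norm (g z) \<le> 1"
  shows "(\<Sum>k<n. (norm (fps_nth (fps_expansion g 0) k))\<^sup>2) \<le> 1"
proof -
  define b where "b = fps_nth (fps_expansion g 0)"
  define Q where "Q = (\<lambda>z. \<Sum>k<n. b k * z ^ k)"
  have holQ: "Q holomorphic_on ball 0 1"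
    unfolding Q_def by (intro holomorphic_intros)
  have b_Q: "fps_nth (fps_expansion Q 0) k = b k" if "k < n" for k
  proof -
    have "Q has_fps_expansion (\<Sum>k<n. fps_const (b k) * fps_X ^ k)"
      unfolding Q_def by (intro fps_expansion_intros)
    moreover have "Q has_fps_expansion fps_expansion Q 0"
      using holQ by (intro has_fps_expansion_fps_expansion[of "ball 0 1"]) auto
    ultimately have "fps_expansion Q 0 = (\<Sum>k<n. fps_const (b k) * fps_X ^ k)"
      using fps_expansion_unique_complex by blast
    then show ?thesis
      using that by (simp add: fps_sum_nth if_distrib[of "\<lambda>x. _ * x"] cong: if_cong)
  qed
  have le_r: "(\<Sum>k<n. (norm (b k))\<^sup>2 * (r ^ k)\<^sup>2) \<le> 1" if r: "0 < r" "r < 1" for r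
  proof -
    define S where "S = (\<Sum>k<n. (norm (b k))\<^sup>2 * (r ^ k)\<^sup>2)"
    \<comment> \<open>Stated for a general \<open>h\<close> because it serves twice: for \<open>g\<close> and for \<open>Q\<close> itself.\<close>
    have inner: "((\<lambda>t. Re (h (r * cis t) * cnj (Q (r * cis t)))) has_integral 2 * pi * S) {0..2 * pi}"
      if h: "h holomorphic_on ball 0 1"
        and coeff: "\<And>k. k < n \<Longrightarrow> fps_nth (fps_expansion h 0) k = b k" for h
    proof -
      have "((\<lambda>t. \<Sum>k<n. cnj (b k) * r ^ k * (h (r * cis t) * cis (- (real k * t))))
         has_integral (\<Sum>k<n. cnj (b k) * r ^ k * (of_real (2 * pi * r ^ k) * fps_nth (fps_expansion h 0) k)))
         {0..2 * pi}"
        by (intro has_integral_sum has_integral_mult_right has_integral_fourier_coefficient h r) simp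
      also have "(\<lambda>t. \<Sum>k<n. cnj (b k) * r ^ k * (h (r * cis t) * cis (- (real k * t))))
          = (\<lambda>t. h (r * cis t) * cnj (Q (r * cis t)))"
        by (simp add: Q_def sum_distrib_left power_mult_distrib Complex.DeMoivre cis_cnj mult_ac)
      also have "(\<Sum>k<n. cnj (b k) * r ^ k * (of_real (2 * pi * r ^ k) * fps_nth (fps_expansion h 0) k))
          = (\<Sum>k<n. of_real (2 * pi * ((norm (b k))\<^sup>2 * (r ^ k)\<^sup>2)))"
      proof (rule sum.cong[OF refl])
        fix k assume "k \<in> {..<n}"
        have "cnj (b k) * r ^ k * (of_real (2 * pi * r ^ k) * b k)
            = of_real (2 * pi) * ((b k * cnj (b k)) * (of_real r ^ k)\<^sup>2)"
          by (simp add: power2_eq_square algebra_simps)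
        also have "\<dots> = of_real (2 * pi * ((norm (b k))\<^sup>2 * (r ^ k)\<^sup>2))"
          by (simp flip: complex_norm_square)
        finally show "cnj (b k) * r ^ k * (of_real (2 * pi * r ^ k) * fps_nth (fps_expansion h 0) k)
            = of_real (2 * pi * ((norm (b k))\<^sup>2 * (r ^ k)\<^sup>2))"
          using coeff \<open>k \<in> {..<n}\<close> by simp
      qed
      also have "\<dots> = of_real (2 * pi * S)"
        by (simp add: S_def sum_distrib_left)
      finally have "((\<lambda>t. h (r * cis t) * cnj (Q (r * cis t))) has_integral of_real (2 * pi * S)) {0..2 * pi}" .
      from has_integral_Re[OF this] show ?thesis
        by (simp only: Re_complex_of_real)
    qed
    have "((\<lambda>t. 1 - 2 * Re (g (r * cis t) * cnj (Q (r * cis t)))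
              + Re (Q (r * cis t) * cnj (Q (r * cis t)))) has_integral
            2 * pi - 2 * (2 * pi * S) + 2 * pi * S) {0..2 * pi}"
      using has_integral_const_real[of "1::real" 0 "2 * pi"]
      by (intro has_integral_add has_integral_diff has_integral_mult_right
            inner hol holQ b_Q) (auto simp: b_def)
    moreover have "0 \<le> 1 - 2 * Re (g (r * cis t) * cnj (Q (r * cis t)))
              + Re (Q (r * cis t) * cnj (Q (r * cis t)))" for t
    proof -
      define u v where "u = g (r * cis t)" and "v = Q (r * cis t)"
      have "norm u \<le> 1"
        unfolding u_def using r by (intro bound) (simp add: norm_mult)
      then have "(norm u)\<^sup>2 \<le> 1"
        by (simp add: power_le_one)
      moreover have "0 \<le> (norm (u - v))\<^sup>2"
        by simp
      ultimately have "0 \<le> 1 - 2 * Re (u * cnj v) + Re (v * cnj v)"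
        unfolding cmod_power2 by (simp add: power2_eq_square algebra_simps)
      then show ?thesis
        by (simp add: u_def v_def)
    qed
    ultimately have "0 \<le> 2 * pi - 2 * (2 * pi * S) + 2 * pi * S"
      by (rule has_integral_nonneg)
    then have "2 * pi * S \<le> 2 * pi * 1"
      by simp
    then have "S \<le> 1"
      by (subst (asm) mult_le_cancel_left_pos) auto
    then show ?thesis
      by (simp add: S_def)
  qed
  have "((\<lambda>r. \<Sum>k<n. (norm (b k))\<^sup>2 * (r ^ k)\<^sup>2) \<longlongrightarrow> (\<Sum>k<n. (norm (b k))\<^sup>2 * (1 ^ k)\<^sup>2)) (at_left (1::real))"
    by (intro tendsto_intros)
  moreover have "\<forall>\<^sub>F r in at_left (1::real). (\<Sum>k<n. (norm (b k))\<^sup>2 * (r ^ k)\<^sup>2) \<le> 1"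
    using eventually_at_left_real[of 0 "1::real"] by (auto elim!: eventually_mono intro: le_r)
  ultimately have "(\<Sum>k<n. (norm (b k))\<^sup>2 * (1 ^ k)\<^sup>2) \<le> 1"
    by (intro tendsto_upperbound) auto
  then show ?thesis
    by (simp add: b_def)
qed

section \<open>Coefficients of functions with positive real part\<close>

text \<open>
  The Moebius map \<open>u \<mapsto> (u - 1) / (u + 1)\<close> takes the right half-plane into the unit disk. The
  relation with \<open>P\<close> is kept free of division, since it is to be compared coefficient by coefficient.
\<close>

lemma schwarz_coefficients_of_positive_real_part:
  assumes hol: "p holomorphic_on ball 0 1" and P: "p has_fps_expansion P"
    and pos: "\<And>z. z \<in> ball 0 1 \<Longrightarrow> Re (p z) > 0"
  obtains W where "W * (P + 1) = P - 1" "\<And>n. (\<Sum>k<n. (norm (fps_nth W k))\<^sup>2) \<le> 1"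
proof
  define \<omega> where "\<omega> = (\<lambda>z. (p z - 1) / (p z + 1))"
  have nz: "p z + 1 \<noteq> 0" if "z \<in> ball 0 1" for z
    using pos[OF that] by (auto simp: complex_eq_iff)
  have hol\<omega>: "\<omega> holomorphic_on ball 0 1"
    unfolding \<omega>_def using nz by (intro holomorphic_intros hol) auto
  have "norm (\<omega> z) \<le> 1" if "z \<in> ball 0 1" for z
  proof -
    have "(norm (p z - 1))\<^sup>2 \<le> (norm (p z + 1))\<^sup>2"
      using pos[OF that] unfolding cmod_power2 by (simp add: power2_eq_square algebra_simps)
    then have "norm (p z - 1) \<le> norm (p z + 1)"
      by (rule power2_le_imp_le) simp
    then show ?thesis
      by (simp add: \<omega>_def norm_divide divide_le_eq)
  qed
  then show "(\<Sum>k<n. (norm (fps_nth (fps_expansion \<omega> 0) k))\<^sup>2) \<le> 1" for n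
    by (intro bessel_inequality_disk hol\<omega>)
  have W: "\<omega> has_fps_expansion fps_expansion \<omega> 0"
    using hol\<omega> by (intro has_fps_expansion_fps_expansion[of "ball 0 1"]) auto
  have "(\<lambda>z. \<omega> z * (p z + 1)) has_fps_expansion fps_expansion \<omega> 0 * (P + 1)"
    by (intro fps_expansion_intros W P)
  moreover have "\<forall>\<^sub>F z in nhds 0. \<omega> z * (p z + 1) = p z - 1"
    using eventually_nhds_in_open[of "ball 0 1" "0::complex"]
    by (auto elim!: eventually_mono simp: \<omega>_def nz)
  ultimately have "(\<lambda>z. p z - 1) has_fps_expansion fps_expansion \<omega> 0 * (P + 1)"
    using has_fps_expansion_cong[OF _ refl, of "\<lambda>z. \<omega> z * (p z + 1)" "\<lambda>z. p z - 1"] by blast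
  moreover have "(\<lambda>z. p z - 1) has_fps_expansion P - 1"
    by (intro fps_expansion_intros P)
  ultimately show "fps_expansion \<omega> 0 * (P + 1) = P - 1"
    using fps_expansion_unique_complex by blast
qed

text \<open>
  Here \<open>fps_deriv (Abs_fps a)\<close> is the expansion of \<open>p = f'\<close>, with coefficients \<open>(n + 1) a\<^bsub>n+1\<^esub>\<close>. Since
  \<open>a\<^sub>1 = 1\<close> forces \<open>w\<^sub>0 = 0\<close>, comparing coefficients determines each \<open>a\<^bsub>n+1\<^esub>\<close> from
  \<open>w\<^sub>1, \<dots>, w\<^sub>n\<close> and the earlier \<open>a\<^sub>k\<close>.
\<close>

lemma coefficients_of_schwarz_relation:
  fixes a :: "nat \<Rightarrow> complex"
  assumes W: "W * (fps_deriv (Abs_fps a) + 1) = fps_deriv (Abs_fps a) - 1" and "a 1 = 1"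
  defines "w \<equiv> fps_nth W"
  shows "a 2 = w 1"
    and "a 3 = 2 / 3 * (w 2 + w 1 ^ 2)"
    and "a 4 = 1 / 2 * (w 3 + 2 * w 1 * w 2 + w 1 ^ 3)"
    and "a 5 = 2 / 5 * (w 4 + 2 * w 1 * w 3 + w 2 ^ 2 + 3 * w 1 ^ 2 * w 2 + w 1 ^ 4)"
proof -
  have conv: "(\<Sum>i\<le>n. w i * (of_nat (n - i + 1) * a (n - i + 1) + (if n - i = 0 then 1 else 0)))
      = of_nat (n + 1) * a (n + 1) - (if n = 0 then 1 else 0)" for n
    using arg_cong[OF W, of "\<lambda>F. fps_nth F n"]
    by (simp add: fps_mult_nth w_def atMost_atLeast0 fps_one_def add.commute)
  have w0: "w 0 = 0"
    using conv[of 0] \<open>a 1 = 1\<close> by simp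
  show a2: "a 2 = w 1"
    using conv[of 1] \<open>a 1 = 1\<close> w0 by (simp add: numeral_2_eq_2)
  have "2 * w 2 + 2 * a 2 * w 1 = 3 * a 3"
    using conv[of 2] \<open>a 1 = 1\<close> w0 by (simp add: eval_nat_numeral algebra_simps)
  then show a3: "a 3 = 2 / 3 * (w 2 + w 1 ^ 2)"
    unfolding a2 by (simp add: field_simps power2_eq_square)
  have "2 * w 3 + 2 * a 2 * w 2 + 3 * a 3 * w 1 = 4 * a 4"
    using conv[of 3] \<open>a 1 = 1\<close> w0 by (simp add: eval_nat_numeral algebra_simps)
  then show a4: "a 4 = 1 / 2 * (w 3 + 2 * w 1 * w 2 + w 1 ^ 3)"
    unfolding a2 a3 by algebra
  have "2 * w 4 + 2 * a 2 * w 3 + 3 * a 3 * w 2 + 4 * a 4 * w 1 = 5 * a 5"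
    using conv[of 4] \<open>a 1 = 1\<close> w0 by (simp add: eval_nat_numeral algebra_simps)
  then show "a 5 = 2 / 5 * (w 4 + 2 * w 1 * w 3 + w 2 ^ 2 + 3 * w 1 ^ 2 * w 2 + w 1 ^ 4)"
    unfolding a2 a3 a4 by algebra
qed

section \<open>Estimating the Hankel determinant\<close>

text \<open>
  Each mixed term is bounded by squares with the remaining factors estimated by 1. The resulting
  weights are about \<open>0.36\<close> for \<open>x\<^sup>2\<close>, \<open>0.32\<close> for \<open>y\<^sup>2\<close>, \<open>0.25\<close> for \<open>s\<^sup>2\<close> and \<open>0.2\<close> for \<open>t\<^sup>2\<close>, all
  below \<open>207/540 = 0.38\<dots>\<close>. The variable \<open>s\<close> already carries weight \<open>1/4\<close>; the terms \<open>x s y\<close> and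
  \<open>x\<^sup>3 s\<close> are therefore charged to \<open>x\<close> and \<open>y\<close> only, since splitting both evenly with \<open>s\<close> would raise its
  weight to \<open>1/4 + 1/10 + 1/20 = 0.4\<close>.
\<close>

lemma hankel_majorant_bound:
  fixes x y s t :: real
  assumes nonneg: "0 \<le> x" "0 \<le> y" "0 \<le> s" "0 \<le> t"
    and sq: "x\<^sup>2 + y\<^sup>2 + s\<^sup>2 + t\<^sup>2 \<le> 1"
  shows "(4/15 * y + 2/15 * x\<^sup>2) * t + s\<^sup>2 / 4 + x * s * (y / 5 + x\<^sup>2 / 10)
    + 4/135 * y ^ 3 + x\<^sup>2 * y\<^sup>2 / 9 + x ^ 4 * y / 45 + 7/540 * x ^ 6 \<le> 207/540"
proof -
  have amgm: "u * v \<le> (u\<^sup>2 + v\<^sup>2) / 2" for u v :: real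
    using sum_squares_bound[of u v] by simp
  have x2: "x\<^sup>2 \<le> 1" and y2: "y\<^sup>2 \<le> 1" and s2: "s\<^sup>2 \<le> 1"
    using sq zero_le_power2[of x] zero_le_power2[of y] zero_le_power2[of s] zero_le_power2[of t]
    by linarith+
  have x1: "x \<le> 1" and y1: "y \<le> 1" and s1: "s \<le> 1"
    using x2 y2 s2 nonneg by (auto simp: power2_le_iff_abs_le power_le_one_iff abs_square_le_1)
  have shrink: "u * v \<le> u" if "0 \<le> u" "v \<le> 1" for u v :: real
    using mult_left_le[OF that(2,1)] .
  have 1: "y * t \<le> (y\<^sup>2 + t\<^sup>2) / 2"
    by (rule amgm)
  have "x * (x * t) \<le> x * t"
    using nonneg x1 by (intro mult_left_le_one_le) auto
  then have 2: "x\<^sup>2 * t \<le> (x\<^sup>2 + t\<^sup>2) / 2"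
    using amgm[of x t] by (simp add: power2_eq_square)
  have 3: "x * y * s \<le> (x\<^sup>2 + y\<^sup>2) / 2"
    using shrink[of "x * y" s] amgm[of x y] nonneg s1 by simp
  have 4: "x\<^sup>2 * (x * s) \<le> x\<^sup>2"
    using nonneg x1 s1 by (intro shrink) (auto intro: mult_le_one)
  have 5: "y\<^sup>2 * y \<le> y\<^sup>2"
    using y1 by (intro shrink) auto
  have "x\<^sup>2 * y\<^sup>2 \<le> x\<^sup>2" "y\<^sup>2 * x\<^sup>2 \<le> y\<^sup>2"
    using x2 y2 by (auto intro!: shrink)
  then have 6: "x\<^sup>2 * y\<^sup>2 \<le> (x\<^sup>2 + y\<^sup>2) / 2"
    by (simp add: mult.commute)
  have 7: "x\<^sup>2 * (x\<^sup>2 * y) \<le> x\<^sup>2"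
    using x2 y1 nonneg by (intro shrink) (auto intro: mult_le_one)
  have 8: "x\<^sup>2 * (x\<^sup>2 * x\<^sup>2) \<le> x\<^sup>2"
    by (intro shrink mult_le_one x2) auto
  have "(4/15 * y + 2/15 * x\<^sup>2) * t + s\<^sup>2 / 4 + x * s * (y / 5 + x\<^sup>2 / 10)
    + 4/135 * y ^ 3 + x\<^sup>2 * y\<^sup>2 / 9 + x ^ 4 * y / 45 + 7/540 * x ^ 6
    = 4/15 * (y * t) + 2/15 * (x\<^sup>2 * t) + s\<^sup>2 / 4 + (x * y * s) / 5 + x\<^sup>2 * (x * s) / 10
    + 4/135 * (y\<^sup>2 * y) + x\<^sup>2 * y\<^sup>2 / 9 + x\<^sup>2 * (x\<^sup>2 * y) / 45 + 7/540 * (x\<^sup>2 * (x\<^sup>2 * x\<^sup>2))"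
    by (simp add: algebra_simps eval_nat_numeral)
  also have "\<dots> \<le> 207/540 * (x\<^sup>2 + y\<^sup>2 + s\<^sup>2 + t\<^sup>2)"
    using 1 2 3 4 5 6 7 8
      zero_le_power2[of x] zero_le_power2[of y] zero_le_power2[of s] zero_le_power2[of t]
    by argo
  also have "\<dots> \<le> 207/540"
    using sq by simp
  finally show ?thesis .
qed

lemma norm_hankel_polynomial_le:
  fixes w1 w2 w3 w4 :: complex
  shows "norm (2/15 * (2 * w2 - w1\<^sup>2) * w4 - w3\<^sup>2 / 4 + w1 * w3 * (2 * w2 - w1\<^sup>2) / 10
      - 4/135 * w2 ^ 3 + w1\<^sup>2 * w2\<^sup>2 / 9 - w1 ^ 4 * w2 / 45 - 7/540 * w1 ^ 6)
    \<le> (4/15 * norm w2 + 2/15 * (norm w1)\<^sup>2) * norm w4 + (norm w3)\<^sup>2 / 4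
      + norm w1 * norm w3 * (norm w2 / 5 + (norm w1)\<^sup>2 / 10)
      + 4/135 * norm w2 ^ 3 + (norm w1)\<^sup>2 * (norm w2)\<^sup>2 / 9 + norm w1 ^ 4 * norm w2 / 45
      + 7/540 * norm w1 ^ 6"
proof -
  have D: "norm (2 * w2 - w1\<^sup>2) \<le> 2 * norm w2 + (norm w1)\<^sup>2"
    using norm_triangle_ineq4[of "2 * w2" "w1\<^sup>2"] by (simp add: norm_mult norm_power)
  have "norm (2/15 * (2 * w2 - w1\<^sup>2) * w4) = norm (2 * w2 - w1\<^sup>2) * (2/15 * norm w4)"
    by (simp only: norm_mult) simp
  also have "\<dots> \<le> (2 * norm w2 + (norm w1)\<^sup>2) * (2/15 * norm w4)"
    by (rule mult_right_mono[OF D]) simp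
  finally have 1: "norm (2/15 * (2 * w2 - w1\<^sup>2) * w4)
      \<le> (4/15 * norm w2 + 2/15 * (norm w1)\<^sup>2) * norm w4"
    by (simp add: algebra_simps)
  have "norm (w1 * w3 * (2 * w2 - w1\<^sup>2) / 10) = norm w1 * norm w3 / 10 * norm (2 * w2 - w1\<^sup>2)"
    by (simp add: norm_mult norm_divide)
  also have "\<dots> \<le> norm w1 * norm w3 / 10 * (2 * norm w2 + (norm w1)\<^sup>2)"
    by (rule mult_left_mono[OF D]) simp
  finally have 2: "norm (w1 * w3 * (2 * w2 - w1\<^sup>2) / 10)
      \<le> norm w1 * norm w3 * (norm w2 / 5 + (norm w1)\<^sup>2 / 10)"
    by (simp add: algebra_simps)
  have "norm (A - B + C - D + E - F - G)
      \<le> norm A + norm B + norm C + norm D + norm E + norm F + norm G" for A B C D E F G :: complex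
    by (intro norm_triangle_le_diff norm_triangle_le add_mono order_refl)
  from this[of "2/15 * (2 * w2 - w1\<^sup>2) * w4" "w3\<^sup>2 / 4" "w1 * w3 * (2 * w2 - w1\<^sup>2) / 10"
      "4/135 * w2 ^ 3" "w1\<^sup>2 * w2\<^sup>2 / 9" "w1 ^ 4 * w2 / 45" "7/540 * w1 ^ 6"]
  show ?thesis
    using 1 2 by (simp add: norm_mult norm_divide norm_power)
qed

theorem theorem1:
  fixes f :: "complex \<Rightarrow> complex" and a :: "nat \<Rightarrow> complex"
  assumes "f \<in> class_R"
    and "normalized_expansion f a"
  shows "norm (third_hankel a) \<le> 207 / 540"
proof -
  from assms(1) have ana: "f analytic_on unit_disk"
    and pos: "\<And>z. z \<in> unit_disk \<Longrightarrow> Re (deriv f z) > 0"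
    by (auto simp: class_R_def class_A_def)
  from assms(2) have a1: "a 1 = 1" and sums: "\<And>z. z \<in> unit_disk \<Longrightarrow> (\<lambda>n. a n * z ^ n) sums f z"
    by (auto simp: normalized_expansion_def)
  have hol: "f holomorphic_on unit_disk"
    using ana by (simp add: analytic_on_open)
  have "f has_fps_expansion Abs_fps a"
    using eventually_nhds_in_open[of unit_disk "0::complex"]
    by (intro has_fps_expansionI) (auto elim!: eventually_mono intro!: sums)
  then have P: "deriv f has_fps_expansion fps_deriv (Abs_fps a)"
    by (rule has_fps_expansion_deriv)
  obtain W where W: "W * (fps_deriv (Abs_fps a) + 1) = fps_deriv (Abs_fps a) - 1"
    and bessel: "\<And>n. (\<Sum>k<n. (norm (fps_nth W k))\<^sup>2) \<le> 1"
    using schwarz_coefficients_of_positive_real_part[OF holomorphic_deriv[OF hol] P pos] by auto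
  define w where "w = fps_nth W"
  note coeffs = coefficients_of_schwarz_relation[OF W a1, folded w_def]
  have hankel: "third_hankel a = 2/15 * (2 * w 2 - (w 1)\<^sup>2) * w 4 - (w 3)\<^sup>2 / 4
      + w 1 * w 3 * (2 * w 2 - (w 1)\<^sup>2) / 10
      - 4/135 * w 2 ^ 3 + (w 1)\<^sup>2 * (w 2)\<^sup>2 / 9 - w 1 ^ 4 * w 2 / 45 - 7/540 * w 1 ^ 6"
    unfolding third_hankel_expand coeffs by (simp add: field_simps eval_nat_numeral)
  show ?thesis
    unfolding hankel
  proof (rule order_trans[OF norm_hankel_polynomial_le hankel_majorant_bound])
    have "(norm (w 0))\<^sup>2 + (norm (w 1))\<^sup>2 + (norm (w 2))\<^sup>2 + (norm (w 3))\<^sup>2 + (norm (w 4))\<^sup>2 \<le> 1"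
      using bessel[of 5] by (simp add: w_def eval_nat_numeral)
    then show "(norm (w 1))\<^sup>2 + (norm (w 2))\<^sup>2 + (norm (w 3))\<^sup>2 + (norm (w 4))\<^sup>2 \<le> 1"
      using zero_le_power2[of "norm (w 0)"] by linarith
  qed simp_all
qed

end
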